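(* Let $t\ge2$, $k\ge1$, $I_1,\ldots,I_t\subseteq[n]$, and let $H=H(I_1,\ldots,I_t)$ be the support hypergraph. The following are equivalent: (i) $\rho(H)=k(t-1)$; (ii) $\mathrm{wt}(I_{[t]})=k(t-1)$; (iii) every tree assignment $G$ of $H$ has exactly $k(t-1)$ labelled graph-edge occurrences and therefore yields a square selected matrix $M_G(x)$.
   Context: For $s\in[n]$ let $e_s=\{j\in[t]:s\in I_j\}$. $H(I_1,\ldots,I_t)$ is the labelled multihypergraph on $[t]$ whose hyperedge occurrences are the pairs $(s,e_s)$ with $|e_s|\ge2$ (equal supports with different $s$ are distinct occurrences). For a hypergraph $H$ with occurrence set $E$, $\rho(H)=\sum_{e\in E}(|e|-1)$. For nonempty $J\subseteq[t]$, $\mathrm{wt}(I_J)=\sum_{j\in J}|I_j|-\bigl|\bigcup_{j\in J}I_j\bigr|$. A (full) tree assignment of $H$ chooses, for each occurrence $(s,e_s)$, a simple tree with vertex set $e_s$, all of whose edges are labelled by that occurrence; $G$ is the labelled multigraph on $[t]$ formed by the disjoint union of all these labelled edge occurrences. For $f\in E(G)$ let $a(f)\in E(K_t)$ be its unordered endpoint pair and $s(f)\in[n]$ the index of its occurrence. Let $K_t$ be the complete graph on $[t]$, $m=\binom t2$, $r=\binom{t-1}2$, and let $\mathbb F$ be a field. $B_t$ is the $r\times m$ matrix over $\mathbb F$ with columns indexed by $E(K_t)$ (lexicographic) and rows indexed by $1\le u<v\le t-1$; row $(u,v)$ has entry $1$ at $\{u,v\}$, $1$ at $\{v,t\}$,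 $-1$ at $\{u,t\}$, and $0$ elsewhere. With indeterminates $x_1,\ldots,x_n$, the selected matrix $M_G(x)$ has $km$ columns indexed by $(i,a)\in\{0,\ldots,k-1\}\times E(K_t)$; its top $kr$ rows form $I_k\otimes B_t$, and it has one further row for each $f\in E(G)$, with entry $x_{s(f)}^i$ in column $(i,a)$ if $a=a(f)$ and $0$ otherwise. It is thus square (of size $km$) when $|E(G)|=k(t-1)$. *)

theory Defs
  imports "Jordan_Normal_Form.Matrix" "HOL-Library.Poly_Mapping"
begin

(* Labelled multihypergraphs: an occurrence is a pair (label, support), so equal supports
   with different labels are distinct. *)

record ('l, 'v) lhypergraph =
  hverts :: "'v set"
  hoccs :: "('l \<times> 'v set) set"

definition rho :: "('l, 'v) lhypergraph \<Rightarrow> int" where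
  "rho H = (\<Sum>(s, e) \<in> hoccs H. int (card e) - 1)"

definition supp_of :: "nat \<Rightarrow> (nat \<Rightarrow> nat set) \<Rightarrow> nat \<Rightarrow> nat set" where
  "supp_of t I s = {j \<in> {1..t}. s \<in> I j}"

definition support_hypergraph :: "nat \<Rightarrow> nat \<Rightarrow> (nat \<Rightarrow> nat set) \<Rightarrow> (nat, nat) lhypergraph" where
  "support_hypergraph n t I =
     \<lparr>hverts = {1..t}, hoccs = {(s, supp_of t I s) | s. s \<in> {1..n} \<and> 2 \<le> card (supp_of t I s)}\<rparr>"

definition wt :: "(nat \<Rightarrow> nat set) \<Rightarrow> nat set \<Rightarrow> int" where
  "wt I J = (\<Sum>j\<in>J. int (card (I j))) - int (card (\<Union>j\<in>J. I j))"

(* A simple graph is given by its vertex set V and a set E of two-element subsets of V. *)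

definition simple_graph :: "'v set \<Rightarrow> 'v set set \<Rightarrow> bool" where
  "simple_graph V E \<longleftrightarrow> (\<forall>a\<in>E. a \<subseteq> V \<and> card a = 2)"

definition graph_connected :: "'v set \<Rightarrow> 'v set set \<Rightarrow> bool" where
  "graph_connected V E \<longleftrightarrow> (\<forall>u\<in>V. \<forall>v\<in>V. (u, v) \<in> {(x, y). {x, y} \<in> E}\<^sup>*)"

(* The closed walk vs!0, vs!1, ..., vs!(length vs - 1), vs!0. *)
definition is_cycle :: "'v set set \<Rightarrow> 'v list \<Rightarrow> bool" where
  "is_cycle E vs \<longleftrightarrow> 3 \<le> length vs \<and> distinct vs \<and>
     (\<forall>i<length vs. {vs ! i, vs ! (Suc i mod length vs)} \<in> E)"

definition simple_tree :: "'v set \<Rightarrow> 'v set set \<Rightarrow> bool" where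
  "simple_tree V E \<longleftrightarrow> V \<noteq> {} \<and> simple_graph V E \<and> graph_connected V E \<and> (\<nexists>vs. is_cycle E vs)"

(* Labelled multigraphs: an edge occurrence is a pair (label, endpoint pair).  In a tree
   assignment the label is the hyperedge occurrence whose tree contributes the edge, so the
   disjoint union of the trees is a Sigma. *)

record ('o, 'v) lmultigraph =
  gverts :: "'v set"
  gedges :: "('o \<times> 'v set) set"

definition tree_assignment ::
  "('l, 'v) lhypergraph \<Rightarrow> ('l \<times> 'v set, 'v) lmultigraph \<Rightarrow> bool" where
  "tree_assignment H G \<longleftrightarrow>
     (\<exists>T. (\<forall>(s, e) \<in> hoccs H. simple_tree e (T (s, e))) \<and>
          G = \<lparr>gverts = hverts H, gedges = Sigma (hoccs H) T\<rparr>)"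

type_synonym ledge = "(nat \<times> nat set) \<times> nat set"

definition edge_ends :: "ledge \<Rightarrow> nat set" where
  "edge_ends f = snd f"

definition edge_index :: "ledge \<Rightarrow> nat" where
  "edge_index f = fst (fst f)"

(* The pairs (u, v) with 1 <= u < v <= t in lexicographic order, representing E(K_t). *)
definition lex_pairs :: "nat \<Rightarrow> (nat \<times> nat) list" where
  "lex_pairs t = concat (map (\<lambda>u. map (Pair u) [Suc u..<Suc t]) [1..<Suc t])"

definition K_edge :: "nat \<Rightarrow> nat \<Rightarrow> nat set" where
  "K_edge t q = (case lex_pairs t ! q of (u, v) \<Rightarrow> {u, v})"

lemma set_lex_pairs: "set (lex_pairs t) = {(u, v). 1 \<le> u \<and> u < v \<and> v \<le> t}"
  by (force simp: lex_pairs_def simp del: upt_Suc)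

lemma distinct_lex_pairs: "distinct (lex_pairs t)"
proof -
  have "distinct (concat (map (\<lambda>u. map (Pair u) [Suc u..<Suc t]) us))" if "distinct us" for us :: "nat list"
    using that by (induction us) (auto simp: distinct_map inj_on_def simp del: upt_Suc)
  then show ?thesis by (simp add: lex_pairs_def del: upt_Suc)
qed

lemma length_lex_pairs: "length (lex_pairs t) = t choose 2"
proof -
  have "card {(u, v). 1 \<le> u \<and> u < v \<and> v \<le> t} = t choose 2"
  proof (induction t)
    case 0
    have "{(u, v). 1 \<le> u \<and> u < v \<and> v \<le> (0::nat)} = {}" by auto
    then show ?case by (simp only: card.empty) simp
  next
    case (Suc t)
    have fin: "finite {(u, v). 1 \<le> u \<and> u < v \<and> v \<le> t}"
      by (rule finite_subset[of _ "{..t} \<times> {..t}"]) auto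
    have un: "{(u, v). 1 \<le> u \<and> u < v \<and> v \<le> Suc t} =
        {(u, v). 1 \<le> u \<and> u < v \<and> v \<le> t} \<union> {1..t} \<times> {Suc t}" by auto
    have "card {(u, v). 1 \<le> u \<and> u < v \<and> v \<le> Suc t} =
        card {(u, v). 1 \<le> u \<and> u < v \<and> v \<le> t} + card ({1..t} \<times> {Suc t})"
      unfolding un by (rule card_Un_disjoint) (use fin in auto)
    then have "card {(u, v). 1 \<le> u \<and> u < v \<and> v \<le> Suc t} = (t choose 2) + t"
      by (simp only: Suc card_cartesian_product) simp
    then show ?case by (simp add: numeral_2_eq_2)
  qed
  then show ?thesis
    by (metis set_lex_pairs distinct_lex_pairs distinct_card)
qed

definition B_matrix :: "nat \<Rightarrow> 'a::field mat" where
  "B_matrix t = mat ((t - 1) choose 2) (t choose 2) (\<lambda>(p, q).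
     case lex_pairs (t - 1) ! p of (u, v) \<Rightarrow>
       if K_edge t q = {u, v} \<or> K_edge t q = {v, t} then 1
       else if K_edge t q = {u, t} then - 1
       else 0)"

definition kronecker :: "'a::times mat \<Rightarrow> 'a mat \<Rightarrow> 'a mat" where
  "kronecker A B = mat (dim_row A * dim_row B) (dim_col A * dim_col B) (\<lambda>(p, q).
     A $$ (p div dim_row B, q div dim_col B) * B $$ (p mod dim_row B, q mod dim_col B))"

(* Polynomials over 'a in indeterminates x_0, x_1, x_2, ... : finitely supported
   coefficient functions on the finitely supported exponent vectors. *)
type_synonym 'a mpolynomial = "(nat \<Rightarrow>\<^sub>0 nat) \<Rightarrow>\<^sub>0 'a"

definition indet :: "nat \<Rightarrow> 'a::field mpolynomial" where
  "indet s = Poly_Mapping.single (Poly_Mapping.single s 1) 1"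

definition const :: "'a::field \<Rightarrow> 'a mpolynomial" where
  "const c = Poly_Mapping.single 0 c"

(* The list fs enumerates the edge occurrences and fixes the order of the rows they
   contribute.  The column (i, a) has number i * m + (lexicographic position of a), where
   m = t choose 2, in agreement with the Kronecker product. *)
definition selected_matrix :: "nat \<Rightarrow> nat \<Rightarrow> ledge list \<Rightarrow> 'a::field mpolynomial mat" where
  "selected_matrix t k fs =
     map_mat const (kronecker (1\<^sub>m k) (B_matrix t)) @\<^sub>r
     mat (length fs) (k * (t choose 2)) (\<lambda>(p, q).
       if K_edge t (q mod (t choose 2)) = edge_ends (fs ! p)
       then indet (edge_index (fs ! p)) ^ (q div (t choose 2))
       else 0)"

end

theory Submission
  imports Defs
begin

text \<open>
  The three conditions all speak about one number.

  Double counting the incidences \<open>s \<in> I j\<close> gives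
  \<open>wt I {1..t} = (\<Sum>s. \<bar>e\<^sub>s\<bar> - 1)\<close>, the sum being over all indices \<open>s\<close> that are covered at
  all. Indices covered exactly once contribute \<open>0\<close>, and the remaining ones are the hyperedge
  occurrences of \<open>H\<close>; so the weight is equal to \<open>\<rho>(H)\<close> for every family of subsets of \<open>{1..n}\<close>
  (lemma \<open>rho_support_hypergraph\<close>). Next, a tree on \<open>e\<^sub>s\<close> has \<open>\<bar>e\<^sub>s\<bar> - 1\<close> edges, and the edges
  contributed by distinct occurrences are kept distinct by their labels; so every tree assignment
  has exactly \<open>\<rho>(H)\<close> labelled edges (lemma \<open>card_gedges_tree_assignment\<close>).

  Condition (iii) quantifies universally over tree assignments, so deducing anything from it
  requires that one exists: take a star on every hyperedge. Finally, the selected matrix has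
  \<open>k (t - 1 choose 2)\<close> rows besides the ones for the edges, and
  \<open>(t - 1 choose 2) + (t - 1) = (t choose 2)\<close> by Pascal's rule. This makes it square when there are
  \<open>k (t - 1)\<close> edges.

  The edge count for trees is proved by removing leaves. A leaf is an end point of a path of maximal
  length, since another edge at that end point would prolong the path or close a cycle.
\<close>

section \<open>Trees\<close>

definition is_path :: "'v set set \<Rightarrow> 'v list \<Rightarrow> bool" where
  "is_path E vs \<longleftrightarrow> distinct vs \<and> successively (\<lambda>x y. {x, y} \<in> E) vs"

lemma finite_simple_graph:
  assumes "finite V" "simple_graph V E"
  shows "finite E"
  by (rule finite_subset[of _ "Pow V"]) (use assms in \<open>auto simp: simple_graph_def\<close>)

lemma is_cycle_prefix_of_path:
  assumes path: "is_path E vs" and i: "2 \<le> i" "i < length vs" and chord: "{vs ! i, vs ! 0} \<in> E"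
  shows "is_cycle E (take (Suc i) vs)"
proof -
  have "{take (Suc i) vs ! j, take (Suc i) vs ! (Suc j mod Suc i)} \<in> E" if "j < Suc i" for j
  proof (cases "j = i")
    case True
    then show ?thesis using chord by simp
  next
    case False
    then have "Suc j < length vs" "Suc j mod Suc i = Suc j" using that i by auto
    then show ?thesis
      using path that False by (simp add: is_path_def successively_conv_nth)
  qed
  moreover have "length (take (Suc i) vs) = Suc i" using i by simp
  moreover have "distinct (take (Suc i) vs)" using path by (simp add: is_path_def)
  ultimately show ?thesis using i unfolding is_cycle_def by simp
qed

text \<open>
  The leaf is the first vertex \<open>v\<close> of a longest path \<open>vs\<close>. Maximality forces every neighbour of \<open>v\<close>
  onto the path, and a neighbour further along than the second vertex would close a cycle.
\<close>

lemma simple_tree_leaf: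
  assumes fin: "finite V" and tree: "simple_tree V E" and two: "2 \<le> card V"
  obtains v w where "{v, w} \<in> E" "v \<noteq> w" "\<And>x. {v, x} \<in> E \<Longrightarrow> x = w"
proof -
  have sub: "\<And>a. a \<in> E \<Longrightarrow> a \<subseteq> V \<and> card a = 2" and conn: "graph_connected V E"
    and acyclic: "\<And>vs. \<not> is_cycle E vs"
    using tree by (auto simp: simple_tree_def simple_graph_def)
  obtain A where "A \<subseteq> V" "card A = 2" using obtain_subset_with_card_n[OF two] by blast
  then obtain a b where ab: "a \<in> V" "b \<in> V" "a \<noteq> b" by (auto simp: card_2_iff)
  then have "(a, b) \<in> {(x, y). {x, y} \<in> E}\<^sup>*" using conn by (simp add: graph_connected_def)
  then obtain c where ac: "{a, c} \<in> E" using ab by (auto elim: converse_rtranclE)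
  have "a \<noteq> c" using sub[OF ac] by auto
  have ac_path: "is_path E [a, c]" using ac \<open>a \<noteq> c\<close> by (simp add: is_path_def)
  define P where "P vs \<longleftrightarrow> is_path E vs \<and> set vs \<subseteq> V" for vs
  have "length vs \<le> card V" if "P vs" for vs
    using that fin by (metis P_def card_mono distinct_card is_path_def)
  moreover have P_ac: "P [a, c]" using ac_path sub[OF ac] by (simp add: P_def)
  ultimately obtain vs where vs: "P vs" and maxi: "\<And>us. P us \<Longrightarrow> length us \<le> length vs"
    using ex_has_greatest_nat[of P "[a, c]" length "Suc (card V)"] by (metis less_Suc_eq_le)
  then have "2 \<le> length vs" using P_ac by force
  then obtain v w ws where vw: "vs = v # w # ws"
    by (metis Suc_le_length_iff numeral_2_eq_2)
  have E_vw: "{v, w} \<in> E" and "v \<noteq> w" using vs by (auto simp: vw P_def is_path_def)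
  have "x = w" if vx: "{v, x} \<in> E" for x
  proof (rule ccontr)
    assume "x \<noteq> w"
    have "x \<in> V" "x \<noteq> v" using sub[OF vx] by auto
    have "x \<in> set vs"
    proof (rule ccontr)
      assume "x \<notin> set vs"
      then have "P (x # vs)"
        using vs vx \<open>x \<in> V\<close> by (auto simp: P_def is_path_def vw insert_commute)
      then show False using maxi by fastforce
    qed
    then obtain i where i: "i < length vs" "vs ! i = x" by (auto simp: in_set_conv_nth)
    have "i \<noteq> 0" using i \<open>x \<noteq> v\<close> by (intro notI) (simp add: vw)
    moreover have "i \<noteq> 1" using i \<open>x \<noteq> w\<close> by (intro notI) (simp add: vw)
    ultimately have "is_cycle E (take (Suc i) vs)"
      using vs i vx by (intro is_cycle_prefix_of_path) (auto simp: P_def vw insert_commute)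
    then show False using acyclic by blast
  qed
  then show thesis using that E_vw \<open>v \<noteq> w\<close> by blast
qed

text \<open>
  Connectedness survives because collapsing the leaf onto its neighbour \<open>w\<close> maps walks to walks:
  the pendant edge becomes stationary, and the other edges stay in place.
\<close>

lemma simple_tree_remove_leaf:
  assumes tree: "simple_tree V E" and vw: "{v, w} \<in> E" "v \<noteq> w"
    and leaf: "\<And>x. {v, x} \<in> E \<Longrightarrow> x = w"
  shows "simple_tree (V - {v}) (E - {{v, w}})"
proof -
  have sub: "\<And>a. a \<in> E \<Longrightarrow> a \<subseteq> V \<and> card a = 2"
    using tree by (auto simp: simple_tree_def simple_graph_def)
  let ?E = "E - {{v, w}}"
  define f where "f x = (if x = v then w else x)" for x
  have walk: "(f x, f y) \<in> {(x, y). {x, y} \<in> ?E}\<^sup>*" if "(x, y) \<in> {(x, y). {x, y} \<in> E}\<^sup>*" for x y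
    using that
  proof induction
    case (step y z)
    have "f y = f z \<or> {f y, f z} \<in> ?E"
    proof (cases "v \<in> {y, z}")
      case True
      then show ?thesis using step.hyps(2) leaf[of y] leaf[of z]
        by (auto simp: f_def insert_commute)
    next
      case False
      then show ?thesis using step.hyps(2) by (auto simp: f_def)
    qed
    then show ?case using step.IH by (auto intro: rtrancl_into_rtrancl)
  qed simp
  have "v \<notin> a" if "a \<in> ?E" for a
  proof
    assume "v \<in> a"
    moreover have "card a = 2" using sub that by blast
    ultimately obtain x where "a = {v, x}" by (auto simp: card_2_iff)
    then show False using leaf that by auto
  qed
  then have "simple_graph (V - {v}) ?E" using sub by (auto simp: simple_graph_def)
  moreover have "graph_connected (V - {v}) ?E"
    unfolding graph_connected_def
  proof (intro ballI)
    fix x y assume "x \<in> V - {v}" "y \<in> V - {v}"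
    then show "(x, y) \<in> {(x, y). {x, y} \<in> ?E}\<^sup>*"
      using walk[of x y] tree by (simp add: f_def simple_tree_def graph_connected_def)
  qed
  moreover have "w \<in> V - {v}" using sub[OF vw(1)] vw(2) by auto
  moreover have "\<not> is_cycle ?E vs" for vs
    using tree by (auto simp: simple_tree_def is_cycle_def)
  ultimately show ?thesis by (auto simp: simple_tree_def)
qed

lemma card_edges_simple_tree:
  assumes "finite V" "simple_tree V E"
  shows "Suc (card E) = card V"
  using assms
proof (induction "card V" arbitrary: V E rule: less_induct)
  case less
  have sg: "simple_graph V E" and "V \<noteq> {}" using less.prems by (auto simp: simple_tree_def)
  have finE: "finite E" by (rule finite_simple_graph[OF less.prems(1) sg])
  show ?case
  proof (cases "2 \<le> card V")
    case False
    then have "card V = 1"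
      using \<open>V \<noteq> {}\<close> less.prems(1) by (metis One_nat_def Suc_1 card_gt_0_iff le_antisym not_less_eq_eq Suc_leI)
    moreover have "a \<notin> E" for a
      using sg False card_mono[OF less.prems(1), of a] by (auto simp: simple_graph_def)
    then have "E = {}" by blast
    ultimately show ?thesis by simp
  next
    case True
    obtain v w where vw: "{v, w} \<in> E" "v \<noteq> w" "\<And>x. {v, x} \<in> E \<Longrightarrow> x = w"
      using simple_tree_leaf[OF less.prems True] by blast
    have vV: "v \<in> V" using sg vw(1) by (auto simp: simple_graph_def)
    have lt: "card (V - {v}) < card V" by (rule card_Diff1_less[OF less.prems(1) vV])
    have "Suc (card (E - {{v, w}})) = card (V - {v})"
      using less.hyps[OF lt] less.prems simple_tree_remove_leaf[OF less.prems(2) vw] by simp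
    then show ?thesis
      using card_Suc_Diff1[OF finE vw(1)] card_Suc_Diff1[OF less.prems(1) vV] by simp
  qed
qed

text \<open>
  Every edge of a star contains the centre. Three consecutive edges of a cycle have no vertex in
  common, so a star has no cycle.
\<close>

lemma simple_tree_star:
  assumes "c \<in> V"
  shows "simple_tree V ((\<lambda>v. {c, v}) ` (V - {c}))"
proof -
  let ?E = "(\<lambda>v. {c, v}) ` (V - {c})"
  let ?R = "{(x, y). {x, y} \<in> ?E}"
  have "(x, y) \<in> ?R\<^sup>*" if "x \<in> V" "y \<in> V" for x y
  proof -
    have "(x, c) \<in> ?R\<^sup>*"
      using that(1) by (cases "x = c") (auto simp: insert_commute)
    moreover have "(c, y) \<in> ?R\<^sup>*"
      using that(2) by (cases "y = c") auto
    ultimately show ?thesis by (rule rtrancl_trans)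
  qed
  then have "graph_connected V ?E" by (simp add: graph_connected_def)
  moreover have "\<not> is_cycle ?E vs" for vs
  proof
    assume "is_cycle ?E vs"
    then have len: "3 \<le> length vs" and dist: "distinct vs"
      and edge: "\<And>i. i < length vs \<Longrightarrow> c = vs ! i \<or> c = vs ! (Suc i mod length vs)"
      unfolding is_cycle_def by blast+
    have c01: "c = vs ! 0 \<or> c = vs ! 1" and c12: "c = vs ! 1 \<or> c = vs ! 2"
      and c23: "c = vs ! 2 \<or> c = vs ! (3 mod length vs)"
    proof -
      have next_index: "Suc 0 mod length vs = 1" "Suc 1 mod length vs = 2"
        "Suc 2 mod length vs = 3 mod length vs"
        using len by simp_all
      have "0 < length vs" "1 < length vs" "2 < length vs" using len by linarith+
      from this[THEN edge] show "c = vs ! 0 \<or> c = vs ! 1" "c = vs ! 1 \<or> c = vs ! 2"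
        "c = vs ! 2 \<or> c = vs ! (3 mod length vs)"
        unfolding next_index by blast+
    qed
    have neq: "vs ! i \<noteq> vs ! j" if "i < length vs" "j < length vs" "i \<noteq> j" for i j
      using that dist by (simp add: nth_eq_iff_index_eq)
    have "3 mod length vs \<noteq> 1"
      using len by (cases "length vs = 3") simp_all
    moreover have "0 < length vs" "1 < length vs" "2 < length vs" "3 mod length vs < length vs"
      using len by (linarith, linarith, linarith, intro mod_less_divisor, linarith)
    ultimately have "vs ! 0 \<noteq> vs ! 2" "vs ! 1 \<noteq> vs ! 2" "vs ! 1 \<noteq> vs ! (3 mod length vs)"
      by (intro neq; simp)+
    then show False using c01 c12 c23 by metis
  qed
  moreover have "simple_graph V ?E" using assms by (auto simp: simple_graph_def card_insert_if)
  ultimately show ?thesis using assms by (auto simp: simple_tree_def)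
qed

section \<open>Tree assignments\<close>

lemma card_gedges_tree_assignment:
  assumes fin: "finite (hoccs H)" "\<And>s e. (s, e) \<in> hoccs H \<Longrightarrow> finite e"
    and G: "tree_assignment H G"
  shows "int (card (gedges G)) = rho H"
proof -
  obtain T where trees: "\<forall>(s, e) \<in> hoccs H. simple_tree e (T (s, e))"
    and ges: "gedges G = Sigma (hoccs H) T"
    using G unfolding tree_assignment_def by fastforce
  have T: "simple_tree e (T (s, e))" if "(s, e) \<in> hoccs H" for s e
    using trees that by blast
  have "finite (T p)" if "p \<in> hoccs H" for p
    using that T fin(2) unfolding simple_tree_def by (cases p) (blast intro: finite_simple_graph)
  then have "int (card (gedges G)) = (\<Sum>p\<in>hoccs H. int (card (T p)))"
    by (simp add: ges card_SigmaI fin(1))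
  also have "\<dots> = rho H"
    unfolding rho_def
  proof (intro sum.cong refl, clarify)
    fix s e assume "(s, e) \<in> hoccs H"
    then have "Suc (card (T (s, e))) = card e" using T fin(2) card_edges_simple_tree by blast
    then show "int (card (T (s, e))) = int (card e) - 1" by simp
  qed
  finally show ?thesis .
qed

lemma ex_tree_assignment:
  assumes "\<And>s e. (s, e) \<in> hoccs H \<Longrightarrow> e \<noteq> {}"
  shows "\<exists>G. tree_assignment H G"
proof -
  define T where "T p = (let e = snd p; c = SOME x. x \<in> e in (\<lambda>v. {c, v}) ` (e - {c}))" for p :: "'a \<times> 'b set"
  have "simple_tree e (T (s, e))" if "(s, e) \<in> hoccs H" for s e
    using assms[OF that] by (auto simp: T_def Let_def some_in_eq intro!: simple_tree_star)
  then show ?thesis unfolding tree_assignment_def by blast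
qed

section \<open>The weight of a set family\<close>

lemma finite_supp_of: "finite (supp_of t I s)"
  by (simp add: supp_of_def)

lemma hoccs_support_hypergraph:
  "hoccs (support_hypergraph n t I) =
     (\<lambda>s. (s, supp_of t I s)) ` {s \<in> {1..n}. 2 \<le> card (supp_of t I s)}"
  by (auto simp: support_hypergraph_def)

lemma rho_support_hypergraph:
  assumes sub: "\<forall>j\<in>{1..t}. I j \<subseteq> {1..n}"
  shows "rho (support_hypergraph n t I) = wt I {1..t}"
proof -
  define U where "U = (\<Union>j\<in>{1..t}. I j)"
  have "U \<subseteq> {1..n}" using sub by (auto simp: U_def)
  then have finU: "finite U" by (rule finite_subset) simp
  have supp_pos: "1 \<le> card (supp_of t I s)" if "s \<in> U" for s
    using that finite_supp_of[of t I s] by (auto simp: U_def supp_of_def Suc_le_eq card_gt_0_iff)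
  have in_U: "s \<in> U" if "2 \<le> card (supp_of t I s)" for s
  proof (rule ccontr)
    assume "s \<notin> U"
    then have "supp_of t I s = {}" by (auto simp: U_def supp_of_def)
    then show False using that by simp
  qed
  have "rho (support_hypergraph n t I)
      = (\<Sum>s\<in>{s \<in> {1..n}. 2 \<le> card (supp_of t I s)}. int (card (supp_of t I s)) - 1)"
    unfolding rho_def hoccs_support_hypergraph
    by (subst sum.reindex) (auto simp: inj_on_def)
  \<comment> \<open>Passing to all covered indices adds those with support of size one, which contribute zero.\<close>
  also have "\<dots> = (\<Sum>s\<in>U. int (card (supp_of t I s)) - 1)"
  proof (rule sum.mono_neutral_left[OF finU])
    show "{s \<in> {1..n}. 2 \<le> card (supp_of t I s)} \<subseteq> U" using in_U by auto
    show "\<forall>s\<in>U - {s \<in> {1..n}. 2 \<le> card (supp_of t I s)}. int (card (supp_of t I s)) - 1 = 0"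
      using supp_pos \<open>U \<subseteq> {1..n}\<close> by (force simp: not_le)
  qed
  also have "\<dots> = int (\<Sum>s\<in>U. card (supp_of t I s)) - int (card U)"
    by (simp add: sum_subtractf)
  also have "(\<Sum>s\<in>U. card (supp_of t I s)) = (\<Sum>j\<in>{1..t}. card (I j))"
  proof -
    have "(\<Sum>s\<in>U. card (supp_of t I s)) = (\<Sum>j\<in>{1..t}. card {s \<in> U. s \<in> I j})"
      unfolding supp_of_def by (rule sum_multicount_gen[symmetric]) (use finU in auto)
    also have "\<dots> = (\<Sum>j\<in>{1..t}. card (I j))"
      by (intro sum.cong arg_cong[of _ _ card]) (auto simp: U_def)
    finally show ?thesis .
  qed
  finally show ?thesis by (simp add: wt_def U_def)
qed

section \<open>The selected matrix\<close>

lemma selected_matrix_square: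
  assumes "t \<ge> 2" and len: "length fs = k * (t - 1)"
  shows "(selected_matrix t k fs :: 'a::field mpolynomial mat)
    \<in> carrier_mat (k * (t choose 2)) (k * (t choose 2))"
proof -
  obtain u where t: "t = Suc u" using assms(1) by (cases t) auto
  have "k * ((t - 1) choose 2) + length fs = k * (t choose 2)"
    unfolding len by (simp add: t numeral_2_eq_2 algebra_simps)
  moreover have "(selected_matrix t k fs :: 'a mpolynomial mat)
      \<in> carrier_mat (k * ((t - 1) choose 2) + length fs) (k * (t choose 2))"
    unfolding selected_matrix_def
    by (rule carrier_append_rows) (auto simp: kronecker_def B_matrix_def)
  ultimately show ?thesis by simp
qed

section \<open>Equivalence of the three conditions\<close>

theorem proposition3p7:
  fixes n t k :: nat and I :: "nat \<Rightarrow> nat set"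
  assumes "t \<ge> 2" and "k \<ge> 1"
    and "\<forall>j\<in>{1..t}. I j \<subseteq> {1..n}"
  defines "H \<equiv> support_hypergraph n t I"
  shows "(rho H = int (k * (t - 1)) \<longleftrightarrow> wt I {1..t} = int (k * (t - 1))) \<and>
    (wt I {1..t} = int (k * (t - 1)) \<longleftrightarrow>
      (\<forall>G. tree_assignment H G \<longrightarrow>
        card (gedges G) = k * (t - 1) \<and>
        (\<forall>fs. distinct fs \<and> set fs = gedges G \<longrightarrow>
          (selected_matrix t k fs :: 'a::field mpolynomial mat)
            \<in> carrier_mat (k * (t choose 2)) (k * (t choose 2)))))"
proof -
  have rho_wt: "rho H = wt I {1..t}"
    unfolding H_def by (rule rho_support_hypergraph[OF assms(3)])
  have card_G: "int (card (gedges G)) = wt I {1..t}" if "tree_assignment H G" for G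
  proof -
    have "int (card (gedges G)) = rho H"
      by (rule card_gedges_tree_assignment[OF _ _ that])
        (auto simp: H_def hoccs_support_hypergraph finite_supp_of)
    then show ?thesis using rho_wt by simp
  qed
  have "\<exists>G. tree_assignment H G"
    by (rule ex_tree_assignment) (auto simp: H_def hoccs_support_hypergraph)
  then obtain G\<^sub>0 where G\<^sub>0: "tree_assignment H G\<^sub>0" ..
  show ?thesis
  proof (intro conjI iffI allI impI)
    fix G assume "wt I {1..t} = int (k * (t - 1))" "tree_assignment H G"
    then show card_eq: "card (gedges G) = k * (t - 1)" using card_G by (metis of_nat_eq_iff)
    fix fs assume "distinct fs \<and> set fs = gedges G"
    then have "length fs = k * (t - 1)" using card_eq distinct_card by fastforce
    then show "(selected_matrix t k fs :: 'a mpolynomial mat)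
        \<in> carrier_mat (k * (t choose 2)) (k * (t choose 2))"
      by (rule selected_matrix_square[OF assms(1)])
  next
    assume "\<forall>G. tree_assignment H G \<longrightarrow> card (gedges G) = k * (t - 1) \<and>
        (\<forall>fs. distinct fs \<and> set fs = gedges G \<longrightarrow>
          (selected_matrix t k fs :: 'a mpolynomial mat)
            \<in> carrier_mat (k * (t choose 2)) (k * (t choose 2)))"
    then have "card (gedges G\<^sub>0) = k * (t - 1)" using G\<^sub>0 by blast
    then show "wt I {1..t} = int (k * (t - 1))" using card_G[OF G\<^sub>0] by simp
  qed (use rho_wt in simp_all)
qed

end
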